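(* Let $p$ be a polynomial with non-negative integer coefficients. The following are equivalent characterizations for the array $(c_{n,k,r}^{p(x)}(q))_{0\le r\le k\le n}$ (where for all other values of the triple $(n,k,r)$ we assume $c_{n,k,r}^{p(x)}(q)=0$): (1) (Defining equation/generating function) $$(x+[p(r)]_q)(x+[p(r+1)]_q)\cdots(x+[p(n-1)]_q)=\sum_{k=r}^n c_{n,k,r}^{p(x)}(q)\,x^{k-r}.$$ (2) (Recursion) For each $n\ge k>r$: $$c_{n,k,r}^{p(x)}(q)=c_{n-1,k-1,r}^{p(x)}(q)+[p(n-1)]_q\,c_{n-1,k,r}^{p(x)}(q),$$ with the boundary conditions $c_{n,r,r}^{p(x)}(q)=[p(r)]_q[p(r+1)]_q\cdots[p(n-1)]_q$ and $c_{r,k,r}^{p(x)}(q)=\delta_{kr}$. (3) (Complete recursion) For $n\ge k>r$: $$c_{n,k,r}^{p(x)}(q)=\sum_{j=k}^n c_{j-1,k-1,r}^{p(x)}(q)\prod_{i=j}^{n-1}[p(i)]_q,$$ subject to the same boundary conditions as in condition (2). (4) (Explicit formula) For $n\ge k\ge r$: $$c_{n,k,r}^{p(x)}(q)=\prod_{j=r}^{n-1}[p(j)]_q\sum_{r\le i_{r+1}<\cdots<i_k\le n-1}\frac{1}{[p(i_{r+1})]_q\cdots[p(i_k)]_q}.$$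
   Context: Here $[m]_q=1+q+\cdots+q^{m-1}=\frac{q^m-1}{q-1}$ is the $q$-analogue of $m$, $\delta$ is the Kronecker delta, and empty products equal $1$. For $p(x)\in\mathbb{Z}[x]$, the (unsigned) type II $q,r$-poly-Stirling numbers of the first kind $c_{n,k,r}^{p(x)}(q)$ are defined by the recurrence $c_{n,k,r}^{p(x)}(q)=c_{n-1,k-1,r}^{p(x)}(q)+[p(n-1)]_q c_{n-1,k,r}^{p(x)}(q)$ for $r\le k\le n$, $n>r$, with $c_{r,r,r}^{p(x)}(q)=1$ and $c_{n,k,r}^{p(x)}(q)=0$ for $k<r$, $k>n$ or $n<r$.
   Formalization: In (4), when some [p(j)]_q with r ≤ j ≤ n-1 vanishes (e.g. p(x)=x, r=0), the reciprocals are undefined; the formula is then read with denominators cancelled, as the sum of products of the [p(j)]_q over the indices j not chosen. *)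

theory Defs
  imports "HOL-Computational_Algebra.Polynomial"
begin

text \<open>
  Throughout, \<open>q\<close> is an arbitrary element of an arbitrary field; the case of an
  indeterminate \<open>q\<close> is the instance of the field of fractions of \<open>\<int>[q]\<close>.
\<close>

text \<open>
  For integer \<open>m\<close> this is \<open>(q^m - 1) / (q - 1)\<close>, continued to \<open>q = 1\<close>; for natural \<open>m\<close> it is
  the sum \<open>1 + q + \<dots> + q^(m-1)\<close>, see \<open>q_bracket_int\<close>.
\<close>

definition q_bracket :: "'a::field \<Rightarrow> int \<Rightarrow> 'a" where
  "q_bracket q m = (if q = 1 then of_int m else (q powi m - 1) / (q - 1))"

lemma q_bracket_int: "q_bracket q (int m) = (\<Sum>i<m. q ^ i)"
  by (simp add: q_bracket_def geometric_sum)

definition q_weight :: "int poly \<Rightarrow> 'a::field \<Rightarrow> nat \<Rightarrow> 'a" where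
  "q_weight p q n = q_bracket q (poly p (int n))"

text \<open>
  Arguments in the order \<open>n k r\<close>. The inner test on \<open>k = 0\<close> only matters for \<open>r = 0\<close>, where
  the entry with second index \<open>k - 1 = -1 < r\<close> is zero.
\<close>

fun poly_stirling1 :: "int poly \<Rightarrow> 'a::field \<Rightarrow> nat \<Rightarrow> nat \<Rightarrow> nat \<Rightarrow> 'a" where
  "poly_stirling1 p q 0 k r = (if k = 0 \<and> r = 0 then 1 else 0)"
| "poly_stirling1 p q (Suc n) k r =
    (if k < r \<or> k > Suc n \<or> Suc n < r then 0
     else if r = Suc n then 1
     else (if k = 0 then 0 else poly_stirling1 p q n (k - 1) r)
            + q_weight p q n * poly_stirling1 p q n k r)"

definition triangular :: "(nat \<Rightarrow> nat \<Rightarrow> nat \<Rightarrow> 'a::zero) \<Rightarrow> bool" where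
  "triangular c \<longleftrightarrow> (\<forall>n k r. \<not> (r \<le> k \<and> k \<le> n) \<longrightarrow> c n k r = 0)"

text \<open>An identity of polynomials in \<open>x\<close>; the factor \<open>[:w, 1:]\<close> is \<open>x + w\<close>.\<close>

definition generating_function ::
    "int poly \<Rightarrow> 'a::field \<Rightarrow> (nat \<Rightarrow> nat \<Rightarrow> nat \<Rightarrow> 'a) \<Rightarrow> bool" where
  "generating_function p q c \<longleftrightarrow>
    (\<forall>n r. r \<le> n \<longrightarrow>
      (\<Prod>j\<in>{r..<n}. [:q_weight p q j, 1:]) = (\<Sum>k=r..n. monom (c n k r) (k - r)))"

definition boundary_conditions ::
    "int poly \<Rightarrow> 'a::field \<Rightarrow> (nat \<Rightarrow> nat \<Rightarrow> nat \<Rightarrow> 'a) \<Rightarrow> bool" where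
  "boundary_conditions p q c \<longleftrightarrow>
    (\<forall>n r. r \<le> n \<longrightarrow> c n r r = (\<Prod>j\<in>{r..<n}. q_weight p q j)) \<and>
    (\<forall>k r. c r k r = (if k = r then 1 else 0))"

definition recursion ::
    "int poly \<Rightarrow> 'a::field \<Rightarrow> (nat \<Rightarrow> nat \<Rightarrow> nat \<Rightarrow> 'a) \<Rightarrow> bool" where
  "recursion p q c \<longleftrightarrow>
    (\<forall>n k r. r < k \<and> k \<le> n \<longrightarrow>
      c n k r = c (n - 1) (k - 1) r + q_weight p q (n - 1) * c (n - 1) k r) \<and>
    boundary_conditions p q c"

definition complete_recursion ::
    "int poly \<Rightarrow> 'a::field \<Rightarrow> (nat \<Rightarrow> nat \<Rightarrow> nat \<Rightarrow> 'a) \<Rightarrow> bool" where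
  "complete_recursion p q c \<longleftrightarrow>
    (\<forall>n k r. r < k \<and> k \<le> n \<longrightarrow>
      c n k r = (\<Sum>j=k..n. c (j - 1) (k - 1) r * (\<Prod>i\<in>{j..<n}. q_weight p q i))) \<and>
    boundary_conditions p q c"

text \<open>
  A choice \<open>r \<le> i\<^sub>r\<^sub>+\<^sub>1 < \<dots> < i\<^sub>k \<le> n - 1\<close> is a \<open>(k - r)\<close>-element subset \<open>I\<close> of \<open>{r..<n}\<close>.
  If some factor vanishes (as \<open>[p(0)]\<^sub>q\<close> does for \<open>p(x) = x\<close> and \<open>r = 0\<close>), the reciprocals are
  undefined; the formula is then read after cancelling the denominators against the product
  in front, which leaves the factors with index outside \<open>I\<close>.
\<close>

definition explicit_formula ::
    "int poly \<Rightarrow> 'a::field \<Rightarrow> (nat \<Rightarrow> nat \<Rightarrow> nat \<Rightarrow> 'a) \<Rightarrow> bool" where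
  "explicit_formula p q c \<longleftrightarrow>
    (\<forall>n k r. r \<le> k \<and> k \<le> n \<longrightarrow>
      c n k r =
        (if \<forall>j\<in>{r..<n}. q_weight p q j \<noteq> 0
         then (\<Prod>j\<in>{r..<n}. q_weight p q j) *
              (\<Sum>I | I \<subseteq> {r..<n} \<and> card I = k - r. 1 / (\<Prod>i\<in>I. q_weight p q i))
         else (\<Sum>I | I \<subseteq> {r..<n} \<and> card I = k - r. \<Prod>j\<in>{r..<n} - I. q_weight p q j)))"

end

theory Submission
  imports Defs
begin

text \<open>
  Fix \<open>r\<close> and write \<open>w j\<close> for \<open>q_weight p q j\<close>. All four conditions are statements about the
  coefficients of the polynomial \<open>P n = (x + w r) \<dots> (x + w (n - 1))\<close>.

  Multiplying \<open>P n\<close> by \<open>x + w n\<close> acts on coefficients by exactly the step of the defining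
  recurrence, so the poly-Stirling numbers are these coefficients
  (\<open>coeff_weight_poly_eq_poly_stirling1\<close>). Condition (1) says the same in one formula
  (\<open>generating_function_iff_coeff\<close>). Expanding \<open>P n\<close> by choosing from every factor either
  \<open>x\<close> or \<open>w j\<close>, the coefficient of \<open>x\<close> to the power \<open>k - r\<close> collects the choices that take
  \<open>x\<close> on a set \<open>I\<close> of \<open>k - r\<close> indices, which is condition (4)
  (\<open>explicit_formula_iff_coeff\<close>).

  Condition (2) is the defining recurrence, except that in the column \<open>k = r\<close>, where the
  recurrence reads \<open>c (Suc n) r r = w n * c n r r\<close>, it prescribes the solution, a product of
  weights; thus it has the poly-Stirling numbers as its only triangular solution
  (\<open>recursion_iff_poly_stirling1\<close>).
  Finally, (3) arises from (2) by substituting the recursion repeatedly into its last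
  summand, and its sum for \<open>n\<close> minus \<open>w (n - 1)\<close> times its sum for \<open>n - 1\<close> is the single
  term \<open>j = n\<close>, which gives (2) back (\<open>complete_recursion_iff_recursion\<close>).
\<close>

abbreviation weight_poly :: "int poly \<Rightarrow> 'a::field \<Rightarrow> nat \<Rightarrow> nat \<Rightarrow> 'a poly" where
  "weight_poly p q r n \<equiv> \<Prod>j\<in>{r..<n}. [:q_weight p q j, 1:]"

section \<open>Triangular arrays and the poly-Stirling numbers\<close>

lemma triangularD: "triangular c \<Longrightarrow> \<not> (r \<le> k \<and> k \<le> n) \<Longrightarrow> c n k r = 0"
  unfolding triangular_def by blast

lemma triangular_eq_iff:
  assumes "triangular c" "triangular d"
  shows "c = d \<longleftrightarrow> (\<forall>n k r. r \<le> k \<and> k \<le> n \<longrightarrow> c n k r = d n k r)"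
  using assms unfolding triangular_def fun_eq_iff by metis

lemma poly_stirling1_eq_0: "\<not> (r \<le> k \<and> k \<le> n) \<Longrightarrow> poly_stirling1 p q n k r = 0"
  by (cases n) auto

lemma triangular_poly_stirling1: "triangular (poly_stirling1 p q)"
  unfolding triangular_def by (blast intro: poly_stirling1_eq_0)

lemma poly_stirling1_diagonal: "poly_stirling1 p q r k r = (if k = r then 1 else 0)"
  by (cases r) auto

lemma poly_stirling1_column:
  "r \<le> n \<Longrightarrow> poly_stirling1 p q (Suc n) r r = q_weight p q n * poly_stirling1 p q n r r"
  by (auto simp: poly_stirling1_eq_0)

lemma poly_stirling1_step:
  assumes "r \<le> n" "r < k"
  shows "poly_stirling1 p q (Suc n) k r =
    poly_stirling1 p q n (k - 1) r + q_weight p q n * poly_stirling1 p q n k r"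
proof (cases "k \<le> Suc n")
  case True
  then show ?thesis using assms by simp
next
  case False
  then have "\<not> k - 1 \<le> n" "\<not> k \<le> n" by linarith+
  then show ?thesis using False by (simp add: poly_stirling1_eq_0 del: One_nat_def)
qed

section \<open>Coefficients of the product of the linear factors\<close>

text \<open>
  The coefficient of \<open>x\<close> to the power \<open>m\<close> in \<open>(x + w n) * P n\<close> is the coefficient of power
  \<open>m - 1\<close> in \<open>P n\<close> plus \<open>w n\<close> times the one of power \<open>m\<close>: the recurrence for \<open>k = r + m\<close>.
\<close>
lemma coeff_weight_poly_eq_poly_stirling1:
  "r \<le> n \<Longrightarrow> coeff (weight_poly p q r n) m = poly_stirling1 p q n (r + m) r"
proof (induction n arbitrary: m rule: dec_induct)
  case base
  then show ?case by (cases m) (auto simp: poly_stirling1_diagonal)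
next
  case (step n)
  have "weight_poly p q r (Suc n) =
      pCons 0 (weight_poly p q r n) + smult (q_weight p q n) (weight_poly p q r n)"
    using step.hyps by (simp add: mult.commute)
  then have "coeff (weight_poly p q r (Suc n)) m =
      (case m of 0 \<Rightarrow> 0 | Suc i \<Rightarrow> coeff (weight_poly p q r n) i)
        + q_weight p q n * coeff (weight_poly p q r n) m"
    by (simp add: coeff_pCons)
  then show ?case
    using step.hyps
    by (cases m) (simp_all add: step.IH poly_stirling1_column poly_stirling1_step
        del: poly_stirling1.simps)
qed

lemma degree_weight_poly: "degree (weight_poly p q r n) \<le> n - r"
  using degree_prod_sum_le[of "{r..<n}" "\<lambda>j. [:q_weight p q j, 1:]"] by simp

lemma coeff_sum_monom_shift:
  assumes "r \<le> n"
  shows "coeff (\<Sum>k=r..n. monom (f k) (k - r)) m = (if r + m \<le> n then f (r + m) else 0)"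
proof -
  have "coeff (\<Sum>k=r..n. monom (f k) (k - r)) m = (\<Sum>k=r..n. if k = r + m then f k else 0)"
    unfolding coeff_sum by (rule sum.cong) auto
  then show ?thesis by simp
qed

text \<open>
  Comparison of coefficients. Above the power \<open>n - r\<close> both sides vanish, because the product
  has only \<open>n - r\<close> linear factors.
\<close>
lemma generating_function_iff_coeff:
  "generating_function p q c \<longleftrightarrow>
    (\<forall>n k r. r \<le> k \<and> k \<le> n \<longrightarrow> c n k r = coeff (weight_poly p q r n) (k - r))"
proof -
  have "weight_poly p q r n = (\<Sum>k=r..n. monom (c n k r) (k - r)) \<longleftrightarrow>
      (\<forall>k. r \<le> k \<and> k \<le> n \<longrightarrow> c n k r = coeff (weight_poly p q r n) (k - r))"
    (is "?eq \<longleftrightarrow> ?coeffs") if "r \<le> n" for n r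
  proof
    assume ?eq
    then show ?coeffs by (simp add: coeff_sum_monom_shift that)
  next
    assume coeffs: ?coeffs
    show ?eq
    proof (rule poly_eqI)
      fix m
      show "coeff (weight_poly p q r n) m = coeff (\<Sum>k=r..n. monom (c n k r) (k - r)) m"
      proof (cases "r + m \<le> n")
        case True
        then show ?thesis using coeffs by (simp add: coeff_sum_monom_shift that)
      next
        case False
        then have "degree (weight_poly p q r n) < m"
          using degree_weight_poly[of p q r n] that by linarith
        then show ?thesis using False by (simp add: coeff_sum_monom_shift that coeff_eq_0)
      qed
    qed
  qed
  then show ?thesis
    unfolding generating_function_def by (meson order_trans)
qed

text \<open>
  The choice in each factor is recorded by the set \<open>I\<close> of those \<open>j\<close> where \<open>x\<close> is taken.
\<close>
lemma coeff_prod_linear_factors: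
  fixes w :: "'b \<Rightarrow> 'a::comm_ring_1"
  assumes "finite A"
  shows "coeff (\<Prod>j\<in>A. [:w j, 1:]) m = (\<Sum>I | I \<subseteq> A \<and> card I = m. \<Prod>j\<in>A - I. w j)"
proof -
  have const: "(\<Prod>j\<in>B. [:w j:]) = [:\<Prod>j\<in>B. w j:]" for B
    by (induction B rule: infinite_finite_induct) (auto simp: one_pCons)
  have "(\<Prod>j\<in>A. [:w j, 1:]) = (\<Prod>j\<in>A. monom 1 1 + [:w j:])"
    by (simp add: monom_altdef)
  also have "\<dots> = (\<Sum>I\<in>Pow A. monom 1 (card I) * [:\<Prod>j\<in>A - I. w j:])"
    using assms by (simp add: prod_add const monom_power)
  also have "coeff \<dots> m = (\<Sum>I\<in>Pow A. if card I = m then \<Prod>j\<in>A - I. w j else 0)"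
    by (simp add: coeff_sum, intro sum.cong) auto
  also have "\<dots> = (\<Sum>I | I \<subseteq> A \<and> card I = m. \<Prod>j\<in>A - I. w j)"
    using assms by (simp add: sum.If_cases) (rule sum.cong, auto)
  finally show ?thesis .
qed

text \<open>If no weight vanishes, the denominators cancel against the product in front.\<close>
lemma explicit_formula_iff_coeff:
  "explicit_formula p q c \<longleftrightarrow>
    (\<forall>n k r. r \<le> k \<and> k \<le> n \<longrightarrow> c n k r = coeff (weight_poly p q r n) (k - r))"
proof -
  let ?w = "q_weight p q"
  have cancel: "(\<Prod>j\<in>A. ?w j) * (\<Sum>I | I \<subseteq> A \<and> card I = m. 1 / (\<Prod>i\<in>I. ?w i)) =
      (\<Sum>I | I \<subseteq> A \<and> card I = m. \<Prod>j\<in>A - I. ?w j)"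
    if "finite A" "\<forall>j\<in>A. ?w j \<noteq> 0" for A m
    unfolding sum_distrib_left
  proof (rule sum.cong)
    fix I assume "I \<in> {I. I \<subseteq> A \<and> card I = m}"
    then have I: "I \<subseteq> A" by simp
    then have "(\<Prod>i\<in>I. ?w i) \<noteq> 0"
      using that by (auto simp: prod_zero_iff finite_subset)
    then show "(\<Prod>j\<in>A. ?w j) * (1 / (\<Prod>i\<in>I. ?w i)) = (\<Prod>j\<in>A - I. ?w j)"
      using that(1) I by (simp add: prod.subset_diff[of I A])
  qed simp
  show ?thesis
    unfolding explicit_formula_def coeff_prod_linear_factors[OF finite_atLeastLessThan]
    by (simp add: cancel cong: if_cong)
qed

section \<open>The two recursions\<close>

lemma poly_stirling1_first_column:
  "r \<le> n \<Longrightarrow> poly_stirling1 p q n r r = (\<Prod>j\<in>{r..<n}. q_weight p q j)"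
  by (induction n rule: dec_induct)
    (simp_all add: poly_stirling1_diagonal poly_stirling1_column mult.commute
      del: poly_stirling1.simps)

lemma recursion_poly_stirling1: "recursion p q (poly_stirling1 p q)"
proof -
  have "poly_stirling1 p q n k r =
      poly_stirling1 p q (n - 1) (k - 1) r + q_weight p q (n - 1) * poly_stirling1 p q (n - 1) k r"
    if "r < k" "k \<le> n" for n k r
    using that poly_stirling1_step[of r "n - 1" k p q] by simp
  then show ?thesis
    unfolding recursion_def boundary_conditions_def
    by (simp add: poly_stirling1_first_column poly_stirling1_diagonal)
qed

text \<open>
  Induction on \<open>n\<close>: the recursion settles the columns \<open>k > r\<close>, and the boundary conditions
  settle the column \<open>k = r\<close>.
\<close>
lemma recursion_unique:
  assumes c: "triangular c" "recursion p q c" and d: "triangular d" "recursion p q d"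
  shows "c n k r = d n k r"
proof (induction n arbitrary: k)
  case 0
  show ?case
  proof (cases "r = 0")
    case True
    then show ?thesis using c d by (simp add: recursion_def boundary_conditions_def)
  next
    case False
    then show ?thesis using c d by (simp add: triangularD)
  qed
next
  case (Suc n)
  consider "\<not> (r \<le> k \<and> k \<le> Suc n)" | "k = r" "r \<le> Suc n" | "r < k" "k \<le> Suc n"
    by linarith
  then show ?case
  proof cases
    case 1
    then show ?thesis using c d by (simp add: triangularD)
  next
    case 2
    then show ?thesis using c d by (simp add: recursion_def boundary_conditions_def)
  next
    case 3
    then have "e (Suc n) k r = e n (k - 1) r + q_weight p q n * e n k r"
      if "recursion p q e" for e
      using that unfolding recursion_def by (metis diff_Suc_1)
    from this[OF c(2)] this[OF d(2)] show ?thesis by (simp add: Suc.IH)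
  qed
qed

lemma recursion_iff_poly_stirling1:
  assumes "triangular c"
  shows "recursion p q c \<longleftrightarrow> c = poly_stirling1 p q"
proof
  assume "recursion p q c"
  then show "c = poly_stirling1 p q"
    using recursion_unique[OF assms _ triangular_poly_stirling1 recursion_poly_stirling1]
    by (intro ext) blast
qed (simp add: recursion_poly_stirling1)

text \<open>The summands with \<open>j < n\<close> all carry the factor \<open>w (n - 1)\<close>.\<close>
lemma complete_sum_Suc:
  fixes a w :: "nat \<Rightarrow> 'a::comm_semiring_1"
  assumes "k \<le> Suc n"
  shows "(\<Sum>j=k..Suc n. a j * (\<Prod>i\<in>{j..<Suc n}. w i)) =
    a (Suc n) + w n * (\<Sum>j=k..n. a j * (\<Prod>i\<in>{j..<n}. w i))"
proof -
  have "(\<Sum>j=k..n. a j * (\<Prod>i\<in>{j..<Suc n}. w i)) =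
      w n * (\<Sum>j=k..n. a j * (\<Prod>i\<in>{j..<n}. w i))"
    unfolding sum_distrib_left by (rule sum.cong) (simp_all add: mult_ac)
  then show ?thesis using assms by (simp add: add.commute)
qed

text \<open>
  Both recursions are governed by \<open>complete_sum_Suc\<close>. On the diagonal \<open>k = n\<close> the sum for
  \<open>n - 1\<close> is empty, and triangularity provides the matching value \<open>c (n - 1) n r = 0\<close>.
\<close>
lemma complete_recursion_iff_recursion:
  fixes c :: "nat \<Rightarrow> nat \<Rightarrow> nat \<Rightarrow> 'a::field"
  assumes tri: "triangular c"
  shows "complete_recursion p q c \<longleftrightarrow> recursion p q c"
proof -
  define T where
    "T n k r = (\<Sum>j=k..n. c (j - 1) (k - 1) r * (\<Prod>i\<in>{j..<n}. q_weight p q i))" for n k r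
  have T_Suc: "T (Suc n) k r = c n (k - 1) r + q_weight p q n * T n k r"
    if "k \<le> Suc n" for n k r
    unfolding T_def by (simp only: complete_sum_Suc[OF that] diff_Suc_1)
  have empty: "c n k r = T n k r" if "n < k" for n k r
    using that tri by (simp add: T_def triangularD)
  have "(\<forall>n k r. r < k \<and> k \<le> n \<longrightarrow> c n k r = T n k r) \<longleftrightarrow>
      (\<forall>n k r. r < k \<and> k \<le> n \<longrightarrow>
        c n k r = c (n - 1) (k - 1) r + q_weight p q (n - 1) * c (n - 1) k r)"
    (is "?complete \<longleftrightarrow> ?step")
  proof
    assume complete: ?complete
    have total: "c n k r = T n k r" if "r < k" for n k r
      using complete empty that by (meson not_le)
    show ?step
    proof (intro allI impI)
      fix n k r :: nat
      assume "r < k \<and> k \<le> n"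
      then obtain m where m: "n = Suc m" "r < k" "k \<le> Suc m" by (cases n) auto
      then show "c n k r = c (n - 1) (k - 1) r + q_weight p q (n - 1) * c (n - 1) k r"
        using total[of r k "Suc m"] total[of r k m] T_Suc[of k m r] by simp
    qed
  next
    assume step: ?step
    have "c n k r = T n k r" if "r < k" for n k r
    proof (induction n)
      case 0
      then show ?case using that by (simp add: empty)
    next
      case (Suc n)
      show ?case
      proof (cases "k \<le> Suc n")
        case True
        then have "c (Suc n) k r = c n (k - 1) r + q_weight p q n * c n k r"
          using step that by (metis diff_Suc_1)
        then show ?thesis using Suc.IH T_Suc[OF True] by simp
      qed (simp add: empty)
    qed
    then show ?complete by blast
  qed
  then show ?thesis
    unfolding complete_recursion_def recursion_def T_def by blast
qed

section \<open>Equivalence of the characterizations\<close>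

lemma poly_stirling1_iff_coeff:
  assumes "triangular c"
  shows "c = poly_stirling1 p q \<longleftrightarrow>
    (\<forall>n k r. r \<le> k \<and> k \<le> n \<longrightarrow> c n k r = coeff (weight_poly p q r n) (k - r))"
  unfolding triangular_eq_iff[OF assms triangular_poly_stirling1]
  by (simp add: coeff_weight_poly_eq_poly_stirling1)

theorem theorem5p2:
  fixes p :: "int poly" and q :: "'a::field" and c :: "nat \<Rightarrow> nat \<Rightarrow> nat \<Rightarrow> 'a"
  assumes "\<forall>i. coeff p i \<ge> 0"
  shows "(c = poly_stirling1 p q \<longleftrightarrow> triangular c \<and> generating_function p q c) \<and>
         (c = poly_stirling1 p q \<longleftrightarrow> triangular c \<and> recursion p q c) \<and>
         (c = poly_stirling1 p q \<longleftrightarrow> triangular c \<and> complete_recursion p q c) \<and>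
         (c = poly_stirling1 p q \<longleftrightarrow> triangular c \<and> explicit_formula p q c)"
proof (cases "triangular c")
  case True
  then show ?thesis
    by (simp only: generating_function_iff_coeff explicit_formula_iff_coeff
        poly_stirling1_iff_coeff[symmetric] complete_recursion_iff_recursion
        recursion_iff_poly_stirling1 simp_thms)
next
  case False
  then show ?thesis using triangular_poly_stirling1 by blast
qed

end
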